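(* Let $n$ be a positive integer. If $n>e^{4200}$, then for all integers $k\geq\lfloor\log n\rfloor$ we have $$p_{n}^{(k)}>\left(\frac{e\cdot k\log k}{\log\log n}\right)^{k}.$$
   Context: $p_n$ denotes the $n$th prime number ($p_1=2$, $p_2=3$, ...). For positive integers $n,k$, define $p_n^{(k)}$ recursively by $p_n^{(1)}:=p_n$ and $p_n^{(k)}:=p_{p_n^{(k-1)}}$ for $k\ge 2$; that is, $p_n^{(k)}$ is the $p_n^{(k-1)}$th prime. $\log$ is the natural logarithm and $e$ is its base. *)

theory Defs
  imports Complex_Main "HOL-Library.Infinite_Set" "HOL-Computational_Algebra.Primes"
begin

text \<open>
  The primes are indexed from 1, whereas \<^const>\<open>enumerate\<close> counts from 0. The value at index 0
  is junk (truncated subtraction).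
\<close>

definition nth_prime :: "nat \<Rightarrow> nat" where
  "nth_prime n = enumerate {p. prime p} (n - 1)"

text \<open>
  \<open>iter_prime n k\<close> stands for $p_n^{(k)}$. The recursion is started one step below
  the first meaningful value \<open>k = 1\<close>; the equations \<open>iter_prime_1\<close> and
  \<open>iter_prime_rec\<close> are the usual defining ones.
\<close>

primrec iter_prime :: "nat \<Rightarrow> nat \<Rightarrow> nat" where
  "iter_prime n 0 = n"
| "iter_prime n (Suc k) = nth_prime (iter_prime n k)"

lemma iter_prime_1: "iter_prime n 1 = nth_prime n"
  by simp

lemma iter_prime_rec: "k \<ge> 2 \<Longrightarrow> iter_prime n k = nth_prime (iter_prime n (k - 1))"
  by (cases k) simp_all

lemma nth_prime_1: "nth_prime 1 = 2"
  by (auto simp: nth_prime_def enumerate_0 intro!: Least_equality dest: prime_ge_2_nat)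

end

theory Submission
  imports Defs "HOL-Number_Theory.Prime_Powers"
    "HOL-Analysis.Complex_Transcendental" "HOL-Analysis.Harmonic_Numbers"
begin

text \<open>
  Put \<open>L = ln n\<close> and let \<open>x j\<close> be the logarithm of the \<open>j\<close>-th iterate, so \<open>x 0 = L\<close>. A lower bound
  \<open>c m ln m\<close> for the \<open>m\<close>-th prime turns into the recursion \<open>x (j + 1) \<ge> x j + ln (x j) + ln c\<close>, and the
  claim into \<open>x k > k (1 + ln k + ln (ln k) - ln (ln L))\<close>. The induction on \<open>k\<close> starts at the integer part
  of \<open>L\<close> with room to spare; its step needs \<open>- ln c < ln (ln L) - 2\<close> up to small terms, and
  \<open>ln (ln 4200)\<close> is about 2.121. So \<open>c = 1\<close> is not needed, but \<open>c\<close> has to exceed about 0.89: the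
  estimate coming from central binomial coefficients is too weak, whereas Chebyshev's estimate
  with the quotient of \<open>N! (N/30)!\<close> by \<open>(N/2)! (N/3)! (N/5)!\<close> gives \<open>c = 0.9\<close>.
\<close>

section \<open>Numerical bounds\<close>

lemma exp_1_gt: "(2718/1000::real) < exp 1"
  using e_approx_32 unfolding abs_le_iff by simp

lemma exp_1_less: "exp 1 < (2719/1000::real)"
  using e_approx_32 unfolding abs_le_iff by simp

text \<open>As \<open>2718/1000 < e\<close>, a logarithm is bounded by comparing powers of
  rationals, which can be evaluated.\<close>

lemma ln_le_fraction:
  fixes x :: real
  assumes "0 < x" "0 < m" "x ^ m \<le> (2718/1000) ^ k"
  shows "ln x \<le> real k / real m"
proof -
  have "(2718/1000 :: real) ^ k \<le> exp 1 ^ k"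
    using exp_1_gt by (intro power_mono) auto
  also have "\<dots> = exp (real k)"
    by (simp add: exp_of_nat_mult[symmetric])
  finally have "ln (x ^ m) \<le> real k"
    using assms by (subst exp_le_cancel_iff[symmetric]) auto
  then show ?thesis
    using assms by (simp add: ln_realpow field_simps)
qed

lemma ln_ge_fraction:
  fixes x :: real
  assumes "0 < x" "0 < m" "(2719/1000) ^ k \<le> x ^ m"
  shows "real k / real m \<le> ln x"
proof -
  have "exp (real k) = exp 1 ^ k"
    by (simp add: exp_of_nat_mult[symmetric])
  also have "\<dots> \<le> (2719/1000) ^ k"
    using exp_1_less by (intro power_mono) auto
  finally have "real k \<le> ln (x ^ m)"
    using assms by (subst ln_ge_iff) auto
  then show ?thesis
    using assms by (simp add: ln_realpow field_simps)
qed

text \<open>The fractions for \<open>ln 2\<close>, \<open>ln 3\<close> and \<open>ln 5\<close> are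
  just sharp enough to keep Chebyshev's constant, about 0.92129, below 0.922.\<close>

lemma ln_2_le: "ln 2 \<le> (43/62::real)"
  using ln_le_fraction[of 2 62 43] by (simp add: power_divide)

lemma ln_3_le: "ln 3 \<le> (11/10::real)"
  using ln_le_fraction[of 3 10 11] by (simp add: power_divide)

lemma ln_5_le: "ln 5 \<le> (66/41::real)"
  using ln_le_fraction[of 5 41 66] by (simp add: power_divide)

lemma ln_4200_ge: "25/3 \<le> ln (4200::real)"
  using ln_ge_fraction[of 4200 3 25] by (simp add: power_divide)

lemma ln_ge_if_ge_4200: "25/3 \<le> ln x" if "4200 \<le> x" for x :: real
  by (rule order.trans[OF ln_4200_ge ln_mono]) (use that in auto)

lemma ln_ln_4200_ge: "36/17 \<le> ln (ln (4200::real))"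
proof -
  have "36/17 \<le> ln (25/3::real)"
    using ln_ge_fraction[of "25/3" 17 36] by (simp add: power_divide)
  also have "\<dots> \<le> ln (ln 4200)"
    using ln_4200_ge by simp
  finally show ?thesis .
qed

section \<open>Chebyshev's estimate\<close>

text \<open>Legendre's formula. The free upper end \<open>M\<close> lets several factorials share
  one index set; terms with \<open>d > N\<close> vanish.\<close>

lemma ln_fact_eq_sum_mangoldt:
  assumes "N \<le> M"
  shows "ln (fact N :: real) = (\<Sum>d = 1..M. mangoldt d * real (N div d))"
  using assms
proof (induction N)
  case 0
  then show ?case by simp
next
  case (Suc N)
  have "d \<le> M" if "d dvd Suc N" for d
    using dvd_imp_le[OF that] Suc.prems by simp
  then have "ln (real (Suc N)) = (\<Sum>d = 1..M. if d dvd Suc N then mangoldt d else 0)"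
    by (subst mangoldt_sum[where 'a = real, simplified, symmetric])
      (auto intro!: sum.mono_neutral_cong_left Nat.gr0I simp: Suc_le_eq split: if_splits)
  then have "ln (fact (Suc N) :: real)
      = (\<Sum>d = 1..M. mangoldt d * real (N div d) + (if d dvd Suc N then mangoldt d else 0))"
    using Suc by (simp add: ln_mult sum.distrib add_ac)
  also have "\<dots> = (\<Sum>d = 1..M. mangoldt d * real (Suc N div d))"
    by (intro sum.cong refl) (auto simp: div_Suc dvd_eq_mod_eq_0 algebra_simps)
  finally show ?case .
qed

definition theta :: "nat \<Rightarrow> real" where
  "theta N = (\<Sum>p | prime p \<and> p \<le> N. ln (real p))"

text \<open>The left side is at most \<open>31 n / 30\<close>, the right side at least
  \<open>(31 n - 29) / 30\<close>, and both are integers.\<close>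

lemma chebyshev_floor_nonneg: "n div 2 + n div 3 + n div 5 \<le> n + n div (30::nat)"
  by linarith

text \<open>The two sides of the previous inequality first agree again at \<open>n = 6\<close>; this
  is why \<open>theta\<close> is compared at \<open>N\<close> and \<open>N div 6\<close>.\<close>

lemma chebyshev_floor_pos:
  "0 < n \<Longrightarrow> n < 6 \<Longrightarrow> n div 2 + n div 3 + n div 5 + 1 \<le> n + n div (30::nat)"
proof -
  assume "0 < n" "n < 6"
  then consider "n = 1" | "n = 2" | "n = 3" | "n = 4" | "n = 5" by linarith
  then show ?thesis by cases auto
qed

text \<open>By Legendre's formula the right side is a sum of \<open>mangoldt d * f (N div d)\<close>
  with nonnegative terms. A prime \<open>p\<close> between \<open>N div 6\<close> and
  \<open>N\<close> has \<open>N div p\<close> in 1..5, where \<open>f\<close> is at least 1.\<close>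

lemma theta_diff_le:
  "theta N - theta (N div 6)
     \<le> ln (fact N) + ln (fact (N div 30)) - ln (fact (N div 2)) - ln (fact (N div 3)) - ln (fact (N div 5))"
proof -
  define f :: "nat \<Rightarrow> real" where
    "f n = real n + real (n div 30) - real (n div 2) - real (n div 3) - real (n div 5)" for n
  have f_nonneg: "f n \<ge> 0" for n
    using chebyshev_floor_nonneg[of n] unfolding f_def by linarith
  have f_pos: "f n \<ge> 1" if "0 < n" "n < 6" for n
    using chebyshev_floor_pos[OF that] unfolding f_def by linarith
  have le: "N div k \<le> N" for k by (rule div_le_dividend)
  have div_swap: "N div 2 div d = N div d div 2" "N div 3 div d = N div d div 3"
    "N div 5 div d = N div d div 5" "N div 30 div d = N div d div 30" for d
    by (metis div_mult2_eq mult.commute)+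
  have "theta N - theta (N div 6) = (\<Sum>p | prime p \<and> N div 6 < p \<and> p \<le> N. ln (real p))"
  proof -
    have "{p. prime p \<and> p \<le> N} = {p. prime p \<and> p \<le> N div 6} \<union> {p. prime p \<and> N div 6 < p \<and> p \<le> N}"
      using le[of 6] by auto
    then have "theta N = theta (N div 6) + (\<Sum>p | prime p \<and> N div 6 < p \<and> p \<le> N. ln (real p))"
      unfolding theta_def by (subst sum.union_disjoint[symmetric]) auto
    then show ?thesis by simp
  qed
  also have "\<dots> \<le> (\<Sum>d = 1..N. mangoldt d * f (N div d))"
  proof (rule order.trans[OF sum_mono sum_mono2])
    fix p assume p: "p \<in> {p. prime p \<and> N div 6 < p \<and> p \<le> N}"
    then have "N div p > 0" by (simp add: div_greater_zero_iff prime_gt_0_nat)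
    moreover have "N div p < 6"
      using p by (simp add: div_less_iff_less_mult prime_gt_0_nat mult.commute)
    ultimately have "1 \<le> f (N div p)" by (rule f_pos)
    then have "ln (real p) * 1 \<le> ln (real p) * f (N div p)"
      using p by (intro mult_left_mono) (auto simp: prime_ge_1_nat)
    then show "ln (real p) \<le> mangoldt p * f (N div p)"
      using p by simp
  qed (auto simp: mangoldt_nonneg f_nonneg prime_ge_1_nat intro: mult_nonneg_nonneg)
  also have "\<dots> = ln (fact N) + ln (fact (N div 30)) - ln (fact (N div 2)) - ln (fact (N div 3)) - ln (fact (N div 5))"
    by (simp only: ln_fact_eq_sum_mangoldt[OF le] ln_fact_eq_sum_mangoldt[OF order.refl, of N] div_swap f_def
        right_diff_distrib distrib_left sum.distrib sum_subtractf)
  finally show ?thesis .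
qed

section \<open>Stirling-type bounds for factorials of quotients\<close>

lemma ln_fact_le:
  assumes "n > 0"
  shows "ln (fact n) \<le> real n * ln (real n) - real n + ln (real n) + 1"
  using assms
proof (induction n rule: nat_induct_non_zero)
  case 1
  then show ?case by simp
next
  case (Suc n)
  define x where "x = real n"
  have x: "x \<ge> 1" using Suc.hyps by (simp add: x_def)
  have "ln (1 + (- 1 / (x + 1))) \<le> - 1 / (x + 1)"
    using x by (intro ln_add_one_self_le_self2) (auto simp: field_simps)
  then have "ln (x / (x + 1)) \<le> - 1 / (x + 1)"
    using x by (simp add: field_simps)
  then have "ln (x + 1) - ln x \<ge> 1 / (x + 1)"
    using x by (simp add: ln_div)
  then have "(x + 1) * (ln (x + 1) - ln x) \<ge> (x + 1) * (1 / (x + 1))"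
    using x by (intro mult_left_mono) auto
  then have "(x + 1) * (ln (x + 1) - ln x) \<ge> 1" using x by simp
  moreover have "ln (fact (Suc n)) = ln (x + 1) + ln (fact n)"
    by (simp add: x_def ln_mult add_ac)
  ultimately show ?case
    using Suc.IH x by (simp add: x_def[symmetric] algebra_simps)
qed

lemma ln_fact_ge: "ln (fact n) \<ge> real n * ln (real n) - real n"
proof (cases "n = 0")
  case False
  then have "n > 0" by simp
  then show ?thesis
  proof (induction n rule: nat_induct_non_zero)
    case (Suc n)
    define x where "x = real n"
    have x: "x \<ge> 1" using Suc.hyps by (simp add: x_def)
    have "ln (1 + 1 / x) \<le> 1 / x"
      using x by (intro ln_add_one_self_le_self) auto
    then have "ln (x + 1) - ln x \<le> 1 / x"
      using x by (simp add: add_divide_distrib[symmetric] ln_div field_simps)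
    then have "x * (ln (x + 1) - ln x) \<le> x * (1 / x)"
      using x by (intro mult_left_mono) auto
    then have "x * (ln (x + 1) - ln x) \<le> 1" using x by simp
    moreover have "ln (fact (Suc n)) = ln (x + 1) + ln (fact n)"
      by (simp add: x_def ln_mult add_ac)
    ultimately show ?case
      using Suc.IH x by (simp add: x_def[symmetric] algebra_simps)
  qed simp
qed simp

text \<open>The derivative is \<open>ln\<close>, nonnegative from 1 on; the proof needs only
  \<open>ln t \<le> t - 1\<close> at \<open>a / b\<close> and \<open>1 / b\<close>. This allows
  replacing \<open>N div k\<close> by the real quotient.\<close>

lemma xlnx_minus_x_mono:
  fixes a b :: real
  assumes "1 \<le> a" "a \<le> b"
  shows "a * ln a - a \<le> b * ln b - b"
proof (cases "a = b")
  case False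
  have "ln (a / b) \<le> a / b - 1"
    using assms by (intro ln_le_minus_one) auto
  then have "ln b - ln a \<ge> 1 - a / b"
    using assms by (simp add: ln_div)
  then have 1: "a * (ln b - ln a) \<ge> a * (1 - a / b)"
    using assms by (intro mult_left_mono) auto
  have "ln (1 / b) \<le> 1 / b - 1"
    using assms by (intro ln_le_minus_one) auto
  moreover have "1 / b \<le> a / b"
    using assms by (intro divide_right_mono) auto
  ultimately have "ln b \<ge> 1 - a / b"
    using assms by (simp add: ln_div)
  then have 2: "(b - a) * ln b \<ge> (b - a) * (1 - a / b)"
    using assms by (intro mult_left_mono) auto
  have "b * ln b - a * ln a = (b - a) * ln b + a * (ln b - ln a)"
    by (simp add: algebra_simps)
  also have "\<dots> \<ge> (b - a) * (1 - a / b) + a * (1 - a / b)"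
    using 1 2 by linarith
  also have "(b - a) * (1 - a / b) + a * (1 - a / b) = b - a"
    using assms by (simp add: field_simps)
  finally show ?thesis by simp
qed simp

lemma ln_fact_div_le:
  assumes "0 < k" "k \<le> N"
  shows "ln (fact (N div k))
    \<le> real N / real k * ln (real N / real k) - real N / real k + ln (real N) + 1"
proof -
  have pos: "N div k > 0" using assms by (simp add: div_greater_zero_iff)
  have le: "real (N div k) \<le> real N / real k" by (rule of_nat_div_le_of_nat)
  have "ln (real (N div k)) \<le> ln (real N)"
    using pos assms by (subst ln_le_cancel_iff) auto
  then show ?thesis
    using ln_fact_le[OF pos] xlnx_minus_x_mono[OF _ le] pos by (simp add: Suc_le_eq)
qed

text \<open>Since the quotient lies below \<open>N div k + 1\<close>, the factorial of the latter is
  estimated, at the cost of one factor of at most \<open>N\<close>.\<close>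

lemma ln_fact_div_ge:
  assumes "2 \<le> k" "k \<le> N"
  shows "ln (fact (N div k))
    \<ge> real N / real k * ln (real N / real k) - real N / real k - ln (real N)"
proof -
  define n where "n = N div k"
  have "N < k * (n + 1)"
    using assms unfolding n_def
    by (metis Suc_eq_plus1 dividend_less_times_div mult_Suc_right not_numeral_le_zero gr_zeroI add.commute)
  then have "real N < real k * real (n + 1)"
    unfolding of_nat_mult[symmetric] of_nat_less_iff .
  then have le: "real N / real k \<le> real (n + 1)"
    using assms by (simp add: divide_le_eq mult.commute)
  have "n + 1 \<le> N"
  proof -
    have "n \<le> N div 2" unfolding n_def using assms by (intro div_le_mono2) auto
    then show ?thesis using assms by linarith
  qed
  then have "ln (real (n + 1)) \<le> ln (real N)"
    by (subst ln_le_cancel_iff) auto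
  moreover have "ln (fact (n + 1)) = ln (real (n + 1)) + ln (fact n)"
    by (simp add: ln_mult)
  moreover have "real N / real k * ln (real N / real k) - real N / real k \<le> ln (fact (n + 1))"
    using assms by (intro order.trans[OF xlnx_minus_x_mono[OF _ le] ln_fact_ge]) auto
  ultimately show ?thesis unfolding n_def by linarith
qed

text \<open>
  The leading terms \<open>x ln x\<close> and \<open>x\<close> cancel because \<open>1 + 1/30 = 1/2 + 1/3 + 1/5\<close>.
\<close>
lemma theta_step:
  assumes "30 \<le> N"
  shows "theta N \<le> theta (N div 6) + 922/1000 * real N + 5 * ln (real N) + 2"
proof -
  define x where "x = real N"
  have x: "x \<ge> 30" using assms by (simp add: x_def)
  have ln_div_x: "ln (x / c) = ln x - ln c" if "c > 0" for c
    using x that by (simp add: ln_div)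
  have "ln (30::real) = ln 2 + ln 3 + ln 5"
    using ln_mult_pos[of "6::real" 5] ln_mult_pos[of "2::real" 3] by simp
  then have "ln 2 / 2 + ln 3 / 3 + ln 5 / 5 - ln 30 / 30 \<le> (922/1000::real)"
    using ln_2_le ln_3_le ln_5_le by linarith
  then have "x * (ln 2 / 2 + ln 3 / 3 + ln 5 / 5 - ln 30 / 30) \<le> x * (922/1000)"
    using x by (intro mult_left_mono) auto
  \<comment> \<open>The two upper bounds contribute \<open>ln x + 1\<close> each, the three lower
    bounds \<open>ln x\<close> each.\<close>
  moreover have "theta N - theta (N div 6)
      \<le> x * (ln 2 / 2 + ln 3 / 3 + ln 5 / 5 - ln 30 / 30) + 5 * ln x + 2"
    using theta_diff_le[of N] ln_fact_le[of N] ln_fact_div_le[of 30 N]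
      ln_fact_div_ge[of 2 N] ln_fact_div_ge[of 3 N] ln_fact_div_ge[of 5 N] assms
    by (simp add: x_def[symmetric] ln_div_x algebra_simps)
  ultimately show ?thesis by (simp add: x_def[symmetric] mult.commute)
qed

section \<open>A linear bound for \<open>theta\<close>\<close>

lemma theta_le_crude: "theta N \<le> real N * ln (real N)"
proof -
  have "theta N \<le> (\<Sum>p\<in>{p. prime p \<and> p \<le> N}. ln (real N))"
    unfolding theta_def by (intro sum_mono) (auto intro!: ln_mono simp: prime_gt_0_nat)
  also have "\<dots> = real (card {p. prime p \<and> p \<le> N}) * ln (real N)"
    by simp
  also have "\<dots> \<le> real N * ln (real N)"
  proof (intro mult_right_mono)
    have "card {p. prime p \<and> p \<le> N} \<le> card {1..N}"
      by (intro card_mono) (auto simp: prime_ge_Suc_0_nat)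
    then show "real (card {p. prime p \<and> p \<le> N}) \<le> real N" by simp
    show "0 \<le> ln (real N)" by (cases "N = 0") auto
  qed
  finally show ?thesis .
qed

text \<open>
  The constant is \<open>0.922 * (1 + 1/6 + 1/36 + ...) = 1.1064\<close>, rounded up to absorb the logarithm.
\<close>
lemma theta_le: "theta N \<le> 1107/1000 * real N + 2 * 10 ^ 7"
proof (induction N rule: less_induct)
  case (less N)
  have ln_million: "ln (10 ^ 6 :: real) \<le> 20"
    using ln_le_fraction[of "10 ^ 6" 1 20] by (simp add: power_divide)
  show ?case
  \<comment> \<open>Up to a million the crude bound suffices; it yields the additive constant
    \<open>10 ^ 6 * 20\<close>.\<close>
  proof (cases "N \<le> 10 ^ 6")
    case True
    have "real N * ln (real N) \<le> 10 ^ 6 * 20"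
    proof (cases "N = 0")
      case False
      have "ln (real N) \<le> ln (10 ^ 6)"
        using True False by (subst ln_le_cancel_iff) auto
      then have "ln (real N) \<le> 20" using ln_million by linarith
      then show ?thesis
        using True False by (intro mult_mono) auto
    qed simp
    then show ?thesis using theta_le_crude[of N] by simp
  next
    case False
    define x where "x = real N"
    have x: "x > 10 ^ 6" using False by (simp add: x_def)
    have "ln x = ln (10 ^ 6) + ln (x / 10 ^ 6)"
      using x by (subst ln_div) auto
    moreover have "ln (x / 10 ^ 6) \<le> x / 10 ^ 6 - 1"
      using x by (intro ln_le_minus_one) auto
    ultimately have "ln x \<le> 20 + x / 10 ^ 6" using ln_million by linarith
    moreover have "theta N \<le> theta (N div 6) + 922/1000 * x + 5 * ln x + 2"
      unfolding x_def using False by (intro theta_step) auto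
    moreover have "theta (N div 6) \<le> 1107/1000 * real (N div 6) + 2 * 10 ^ 7"
      using False by (intro less) auto
    moreover have "real (N div 6) \<le> x / 6" unfolding x_def using of_nat_div_le_of_nat[of N 6] by simp
    \<comment> \<open>The slack \<open>1.107 * 5/6 - 0.922 = 0.0005\<close> per unit of
      \<open>x\<close> pays for \<open>5 * ln x + 2\<close>.\<close>
    ultimately show ?thesis using x unfolding x_def[symmetric] by simp
  qed
qed

section \<open>A lower bound for the nth prime\<close>

lemma prime_nth_prime: "prime (nth_prime n)"
  unfolding nth_prime_def using enumerate_in_set[OF primes_infinite] by simp

lemma le_card_primes_nth_prime: "m \<le> card {p. prime p \<and> p \<le> nth_prime m}"
proof -
  have "enumerate {p. prime p} ` {..<m} \<subseteq> {p. prime p \<and> p \<le> nth_prime m}"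
    unfolding nth_prime_def using enumerate_in_set[OF primes_infinite] primes_infinite by auto
  then have "card (enumerate {p::nat. prime p} ` {..<m}) \<le> card {p. prime p \<and> p \<le> nth_prime m}"
    by (intro card_mono) auto
  then show ?thesis
    using inj_on_subset[OF inj_enumerate[OF primes_infinite]] by (simp add: card_image)
qed

text \<open>At most \<open>Y\<close> primes are discarded, and each remaining one contributes at
  least \<open>ln Y\<close>; this replaces partial summation.\<close>

lemma card_primes_theta:
  assumes "Y > 0"
  shows "(real (card {p. prime p \<and> p \<le> N}) - real Y) * ln (real Y) \<le> theta N"
proof -
  let ?P = "{p. prime p \<and> p \<le> N}"
  have "card ?P \<le> card ({p. prime p \<and> Y < p \<and> p \<le> N} \<union> {1..Y})"
    by (intro card_mono) (auto simp: prime_ge_Suc_0_nat)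
  also have "\<dots> \<le> card {p. prime p \<and> Y < p \<and> p \<le> N} + Y"
    using card_Un_le[of "{p. prime p \<and> Y < p \<and> p \<le> N}" "{1..Y}"] by simp
  finally have "(real (card ?P) - real Y) * ln (real Y)
      \<le> real (card {p. prime p \<and> Y < p \<and> p \<le> N}) * ln (real Y)"
    using assms by (intro mult_right_mono) auto
  also have "\<dots> = (\<Sum>p | prime p \<and> Y < p \<and> p \<le> N. ln (real Y))" by simp
  also have "\<dots> \<le> (\<Sum>p | prime p \<and> Y < p \<and> p \<le> N. ln (real p))"
    using assms by (intro sum_mono) auto
  also have "\<dots> \<le> theta N"
    unfolding theta_def by (intro sum_mono2) (auto intro!: ln_ge_zero simp: prime_ge_Suc_0_nat)
  finally show ?thesis .
qed

text \<open>If the prime were smaller, \<open>theta\<close> there would be at most about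
  \<open>1.107 * 0.9 = 0.9963\<close> times \<open>m ln m\<close>, while the first \<open>m\<close>
  primes force nearly \<open>0.999\<close> times \<open>m ln m\<close>.\<close>

lemma nth_prime_ge:
  assumes "4200 \<le> ln (real m)"
  shows "nth_prime m \<ge> 0.9 * real m * ln (real m)"
proof (rule ccontr)
  assume less: "\<not> ?thesis"
  define M where "M = ln (real m)"
  have M: "M \<ge> 4200" using assms by (simp add: M_def)
  have m_pos: "m > 0" using assms by (intro Nat.gr0I) auto
  have m: "real m \<ge> 10 ^ 7"
  proof -
    have "ln ((10::real) ^ 7) \<le> 20"
      using ln_le_fraction[of "10 ^ 7" 1 20] by (simp add: power_divide)
    then have "ln ((10::real) ^ 7) \<le> ln (real m)" using assms by linarith
    then show ?thesis using m_pos by (subst (asm) ln_le_cancel_iff) auto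
  qed
  \<comment> \<open>This choice discards at most a thousandth of the \<open>m\<close> primes and
    lowers the logarithm by at most \<open>ln 2000 \<le> 8\<close>.\<close>
  define Y where "Y = m div 1000"
  have Y: "real Y \<ge> real m / 2000" "real Y \<le> real m / 1000"
  proof -
    show "real Y \<le> real m / 1000" unfolding Y_def using of_nat_div_le_of_nat[of m 1000] by simp
    have "1000 \<le> m" using m by simp
    then have "1 \<le> Y" unfolding Y_def by (simp add: Suc_le_eq div_greater_zero_iff)
    moreover have "m = 1000 * Y + m mod 1000" "m mod 1000 < 1000" unfolding Y_def by simp_all
    ultimately have "m \<le> 2000 * Y" by linarith
    then show "real Y \<ge> real m / 2000" by linarith
  qed
  have lnY: "ln (real Y) \<ge> M - 8"
  proof -
    have "ln (2000::real) \<le> 8"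
      using ln_le_fraction[of 2000 1 8] by (simp add: power_divide)
    then have "M - 8 \<le> ln (real m / 2000)"
      using m_pos by (simp add: ln_div M_def)
    also have "\<dots> \<le> ln (real Y)"
      using Y m by (subst ln_le_cancel_iff) auto
    finally show ?thesis .
  qed
  have "(999/1000 * real m) * (M - 8) \<le> (real (card {p. prime p \<and> p \<le> nth_prime m}) - real Y) * ln (real Y)"
    using le_card_primes_nth_prime[of m] lnY M m Y by (intro mult_mono) auto
  also have "\<dots> \<le> theta (nth_prime m)"
    using Y m by (intro card_primes_theta) (auto intro!: Nat.gr0I)
  also have "\<dots> \<le> 1107/1000 * (0.9 * real m * M) + 2 * 10 ^ 7"
    using theta_le[of "nth_prime m"] less by (simp add: M_def)
  \<comment> \<open>Here \<open>0.0027 = 0.999 - 1.107 * 0.9\<close> and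
    \<open>7.992 = 0.999 * 8\<close>. As \<open>0.0027 * 4200 = 11.34\<close>, the left side wins
    once \<open>m\<close> is at least \<open>10 ^ 7\<close>.\<close>
  finally have "0.0027 * (real m * M) \<le> 7.992 * real m + 2 * 10 ^ 7"
    by (simp add: algebra_simps)
  moreover have "real m * M \<ge> real m * 4200"
    using M by (intro mult_left_mono) auto
  ultimately show False using m by simp
qed

section \<open>Growth of the iterated logarithms\<close>

text \<open>With \<open>L = ln n\<close> this is the logarithm of the bound claimed in the
  theorem.\<close>

definition log_bound :: "real \<Rightarrow> real \<Rightarrow> real" where
  "log_bound L k = k * (1 + ln k + ln (ln k) - ln (ln L))"

text \<open>With \<open>v = ln k\<close> and \<open>l = ln (ln L)\<close>, the increment is about
  \<open>2 + v + ln v - l + 1/v\<close>, and \<open>ln (log_bound L k)\<close> is at least about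
  \<open>v + ln v + 1/v\<close>. What remains is \<open>l > 2.106\<close> plus small errors, and
  \<open>36/17\<close> is about 2.1176.\<close>

lemma log_bound_step:
  assumes "4200 < L" "L \<le> k + 1" "4200 \<le> k"
  shows "log_bound L (k + 1) \<le> log_bound L k + ln (log_bound L k) - 106/1000"
    and "log_bound L k > 0"
proof -
  define v where "v = ln k"
  define l where "l = ln (ln L)"
  have v: "v \<ge> 25/3"
    using ln_ge_if_ge_4200 assms unfolding v_def by simp
  have lnL: "ln L \<ge> 25/3"
    using ln_ge_if_ge_4200 assms by simp
  have l: "l \<ge> 36/17"
  proof -
    have "ln (ln 4200) \<le> l"
      unfolding l_def using assms ln_4200_ge lnL by simp
    then show ?thesis using ln_ln_4200_ge by simp
  qed
  have ln_k1: "ln (k + 1) \<le> v + 1 / k"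
  proof -
    have "ln (k + 1) = v + ln (1 + 1 / k)"
      unfolding v_def using assms
      by (subst ln_mult_pos[symmetric]) (auto simp: distrib_left add_ac intro: add_pos_pos)
    moreover have "ln (1 + 1 / k) \<le> 1 / k"
      using assms by (intro ln_add_one_self_le_self) auto
    ultimately show ?thesis by simp
  qed
  have ln_ln_k1: "ln (ln (k + 1)) \<le> ln v + 1 / (k * v)"
  proof -
    have "0 < ln (k + 1)" using assms by simp
    then have "ln (ln (k + 1)) \<le> ln (v + 1 / k)"
      using ln_k1 by simp
    also have "\<dots> = ln v + ln (1 + 1 / (k * v))"
    proof -
      have "v + 1 / k = v * (1 + 1 / (k * v))" "0 < 1 + 1 / (k * v)"
        using assms v by (auto simp: distrib_left intro!: add_pos_pos)
      then show ?thesis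
        using v ln_mult_pos[of v "1 + 1 / (k * v)"] by simp
    qed
    also have "ln (1 + 1 / (k * v)) \<le> 1 / (k * v)"
      using assms v by (intro ln_add_one_self_le_self) auto
    finally show ?thesis by simp
  qed
  have inv_k: "1 / k \<le> 1 / 4200"
    using assms by (intro divide_left_mono) auto
  have inv_kv: "1 / (k * v) \<le> 1 / 4200"
  proof -
    have "4200 * 1 \<le> k * v" using assms v by (intro mult_mono) auto
    then show ?thesis by (intro divide_left_mono) auto
  qed
  \<comment> \<open>At the first \<open>k\<close>, the floor of \<open>L\<close>, \<open>k\<close>
    may lie below \<open>L\<close>, so \<open>ln v - l\<close> may be slightly negative.\<close>
  have "ln (ln L) \<le> ln (ln (k + 1))"
    using assms lnL by (intro ln_mono) auto
  then have w: "ln v - l \<ge> - 1 / 4200"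
    using ln_ln_k1 inv_kv unfolding l_def by linarith
  then show pos: "log_bound L k > 0"
    unfolding log_bound_def v_def[symmetric] l_def[symmetric] using v assms
    by (intro mult_pos_pos) linarith+
  define s :: real where "s = 1 - 1 / 4200"
  have "ln (1 + v + ln v - l) \<ge> ln (v + s)"
    using w v by (simp add: s_def)
  \<comment> \<open>The midpoint rule underestimates the integral of the convex function
    \<open>1 / t\<close> from \<open>v\<close> to \<open>v + s\<close>.\<close>
  moreover have "ln (v + s) - ln v \<ge> 2 * s / (2 * v + s)"
    using ln_inverse_approx_ge[of v "v + s"] v by (simp add: s_def field_simps)
  moreover have "2 * s / (2 * v + s) \<ge> 2 * s / (2 * v + 1)"
    using v by (intro divide_left_mono) (auto simp: s_def)
  moreover have "2 * s / (2 * v + 1) \<ge> 1 / v - 8/1000"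
  proof -
    have "1 / v - 2 / (2 * v + 1) = 1 / (v * (2 * v + 1))"
      using v by (simp add: field_simps)
    also have "\<dots> \<le> 1 / (25/3 * (2 * 25/3 + 1))"
      using v by (intro divide_left_mono mult_mono mult_pos_pos) auto
    also have "\<dots> \<le> 7/1000" by simp
    finally have "1 / v - 2 / (2 * v + 1) \<le> 7/1000" .
    moreover have "2 / 4200 / (2 * v + 1) \<le> 2 / 4200 / 1"
      using v by (intro divide_left_mono) auto
    moreover have "2 * s = 2 - 2 / 4200" by (simp add: s_def)
    then have "2 * s / (2 * v + 1) = 2 / (2 * v + 1) - 2 / 4200 / (2 * v + 1)"
      by (simp only: diff_divide_distrib)
    ultimately show ?thesis by linarith
  qed
  moreover have "ln (log_bound L k) = v + ln (1 + v + ln v - l)"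
    unfolding log_bound_def v_def[symmetric] l_def[symmetric]
    using assms w v by (subst ln_mult_pos) (auto simp: v_def)
  moreover have "log_bound L (k + 1) - log_bound L k \<le> 2 + v + ln v - l + 1 / v + 1 / k + 1 / (k * v)"
  proof -
    have "log_bound L (k + 1) \<le> (k + 1) * (1 + (v + 1 / k) + (ln v + 1 / (k * v)) - l)"
      unfolding log_bound_def l_def[symmetric] using ln_k1 ln_ln_k1 assms
      by (intro mult_left_mono) auto
    also have "\<dots> = log_bound L k + (2 + v + ln v - l + 1 / v + 1 / k + 1 / (k * v))"
      unfolding log_bound_def v_def[symmetric] l_def[symmetric] using assms v by (simp add: field_simps)
    finally show ?thesis by simp
  qed
  ultimately show "log_bound L (k + 1) \<le> log_bound L k + ln (log_bound L k) - 106/1000"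
    using inv_k inv_kv l by simp
qed

lemma log_growth:
  fixes x :: "nat \<Rightarrow> real"
  assumes L: "4200 < L"
    and x0: "x 0 \<ge> L"
    and x_step: "\<And>j. x j \<ge> L \<Longrightarrow> x (Suc j) \<ge> x j + ln (x j) - 106/1000"
    and k: "nat \<lfloor>L\<rfloor> \<le> k"
  shows "x k > log_bound L (real k)"
proof -
  have lnL: "ln L \<ge> 25/3"
    using ln_ge_if_ge_4200 L by simp
  have floor_L: "4200 \<le> \<lfloor>L\<rfloor>" using L by (simp add: le_floor_iff)
  have ge_L: "x j \<ge> L" for j
  proof (induction j)
    case (Suc j)
    then have "ln (x j) \<ge> ln L" using L by simp
    then show ?case using Suc x_step[OF Suc] lnL by linarith
  qed (use x0 in simp)
  show ?thesis
    using k
  proof (induction k rule: dec_induct)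
    case base
    \<comment> \<open>Steps of size \<open>a\<close> alone miss the target
      \<open>K * (1 + ln K)\<close> by about \<open>0.106 * K\<close>. The second half of the steps
      gains 1 more each, about \<open>K / 2\<close> in total, which covers this.\<close>
    define a where "a = ln L - 106/1000"
    have linear: "x j \<ge> L + real j * a" for j
    proof (induction j)
      case (Suc j)
      have "x (Suc j) \<ge> x j + ln (x j) - 106/1000" "ln (x j) \<ge> ln L"
        using x_step[OF ge_L] ge_L[of j] L by auto
      then have "x (Suc j) \<ge> x j + a" unfolding a_def by linarith
      then show ?case using Suc by (simp add: algebra_simps)
    qed (use x0 in simp)
    define K where "K = nat \<lfloor>L\<rfloor>"
    have K: "real K \<le> L" "L < real K + 1" "real K \<ge> 4200"
      using floor_L unfolding K_def by linarith+
    define h where "h = K div 2"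
    have h: "2 * real h \<ge> real K - 1" "2 * real h \<le> real K"
    proof -
      have "2 * h \<le> K" "K \<le> 2 * h + 1" unfolding h_def by simp_all
      then show "2 * real h \<ge> real K - 1" "2 * real h \<le> real K" by simp_all
    qed
    \<comment> \<open>After half of the steps \<open>x\<close> exceeds \<open>e L\<close>, so each later step gains at least \<open>1 + ln L - 0.106\<close>.\<close>
    have late: "x (h + j) \<ge> L + real h * a + real j * (a + 1)" for j
    proof (induction j)
      case 0
      then show ?case using linear[of h] by simp
    next
      case (Suc j)
      \<comment> \<open>Since \<open>a > 8\<close>, the first \<open>h\<close> steps add at least
        \<open>2 * L\<close>, and \<open>3 * L\<close> exceeds \<open>e * L\<close>.\<close>
      have "2 * L \<le> real h * 8"
        using h K L by linarith
      also have "\<dots> \<le> real h * a"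
        using lnL unfolding a_def by (intro mult_left_mono) auto
      finally have "3 * L \<le> L + real h * a" by simp
      also have "\<dots> \<le> L + real (h + j) * a"
        using lnL unfolding a_def by (intro add_left_mono mult_right_mono) auto
      also have "\<dots> \<le> x (h + j)" by (rule linear)
      finally have "3 * L \<le> x (h + j)" .
      moreover have "exp 1 * L \<le> 3 * L"
        using exp_le L by (intro mult_right_mono) auto
      ultimately have "exp 1 * L \<le> x (h + j)" by linarith
      then have "ln (exp 1 * L) \<le> ln (x (h + j))"
        using L ge_L[of "h + j"] by (subst ln_le_cancel_iff) auto
      then have "1 + ln L \<le> ln (x (h + j))"
        using L by (simp add: ln_mult_pos)
      then have "x (Suc (h + j)) \<ge> x (h + j) + (a + 1)"
        using x_step[OF ge_L[of "h + j"]] unfolding a_def by linarith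
      then show ?case using Suc by (simp add: algebra_simps)
    qed
    have "h \<le> K" unfolding h_def by simp
    then have "x K \<ge> L + real h * a + (real K - real h) * (a + 1)"
      using late[of "K - h"] by (simp add: of_nat_diff)
    also have "L + real h * a + (real K - real h) * (a + 1) = L + real K * a + (real K - real h)"
      by (simp add: algebra_simps)
    also have "real K * a = real K * ln L - 106/1000 * real K"
      unfolding a_def by (simp add: right_diff_distrib)
    finally have "x K > L + real K * ln L" using h K by linarith
    moreover have "real K * ln L \<ge> real K * ln (real K)"
      using K L by (intro mult_left_mono) auto
    moreover have "ln (ln (real K)) \<le> ln (ln L)"
      using K L by simp
    then have "log_bound L (real K) \<le> real K * (1 + ln (real K))"
      unfolding log_bound_def by (intro mult_left_mono) auto
    ultimately show ?case
      using K unfolding K_def[symmetric] distrib_left by linarith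
  next
    case (step k)
    have k: "L \<le> real k + 1" "4200 \<le> real k"
      using step.hyps floor_L by linarith+
    have "x (Suc k) \<ge> x k + ln (x k) - 106/1000" by (rule x_step[OF ge_L])
    moreover have "ln (x k) \<ge> ln (log_bound L (real k))"
      using step.IH log_bound_step(2)[OF L k] by simp
    moreover note step.IH log_bound_step(1)[OF L k]
    ultimately show ?case by (simp add: add.commute)
  qed
qed

section \<open>Application to the iterated primes\<close>

lemma ln_iter_prime_step:
  assumes "4200 \<le> ln (real (iter_prime n j))"
  shows "ln (real (iter_prime n (Suc j)))
    \<ge> ln (real (iter_prime n j)) + ln (ln (real (iter_prime n j))) - 106/1000"
proof -
  define m where "m = iter_prime n j"
  have M: "4200 \<le> ln (real m)" using assms by (simp add: m_def)
  have m: "m > 1"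
  proof (rule ccontr)
    assume "\<not> ?thesis"
    then have "m = 0 \<or> m = 1" by auto
    then show False using M by auto
  qed
  \<comment> \<open>The quadratic Taylor bound suffices: \<open>106/1000\<close> slightly exceeds
    \<open>- ln 0.9\<close>, about 0.10536.\<close>
  have "1 / 0.9 \<le> 1 + 106/1000 + (106/1000)\<^sup>2 / (2::real)" by (simp add: power_divide)
  also have "\<dots> \<le> exp (106/1000)"
    by (intro exp_lower_Taylor_quadratic) auto
  finally have "exp (-(106/1000)) \<le> (0.9::real)"
    by (simp add: exp_minus field_simps)
  then have "- (106/1000) \<le> ln (0.9::real)"
    by (subst ln_ge_iff) auto
  moreover have "ln (0.9 * real m * ln (real m)) = ln 0.9 + ln (real m) + ln (ln (real m))"
    using ln_mult_pos[of "0.9::real" "real m"] ln_mult_pos[of "0.9 * real m" "ln (real m)"] m M by simp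
  ultimately have "ln (real m) + ln (ln (real m)) - 106/1000 \<le> ln (0.9 * real m * ln (real m))"
    by linarith
  also have "\<dots> \<le> ln (real (nth_prime m))"
    using nth_prime_ge[OF M] m M by (intro ln_mono mult_pos_pos) auto
  finally show ?thesis by (simp add: m_def)
qed

theorem lemma2p3:
  fixes n :: nat
  assumes "n > 0" and "real n > exp 1 ^ 4200"
  shows "\<forall>k::nat. int k \<ge> \<lfloor>ln (real n)\<rfloor> \<longrightarrow>
           real (iter_prime n k) > (exp 1 * real k * ln (real k) / ln (ln (real n))) ^ k"
proof (intro allI impI)
  fix k :: nat
  assume k: "int k \<ge> \<lfloor>ln (real n)\<rfloor>"
  define L where "L = ln (real n)"
  have "exp 4200 = exp (1::real) ^ 4200"
    using exp_of_nat_mult[of 4200 "1::real"] by simp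
  then have L: "4200 < L"
    unfolding L_def using assms by (subst exp_less_cancel_iff[symmetric]) auto
  have k_ge: "real k \<ge> 4200" "nat \<lfloor>L\<rfloor> \<le> k"
  proof -
    have "4200 \<le> \<lfloor>L\<rfloor>" using L by (simp add: le_floor_iff)
    then show "real k \<ge> 4200" "nat \<lfloor>L\<rfloor> \<le> k"
      using k unfolding L_def by linarith+
  qed
  have "log_bound L (real k) < ln (real (iter_prime n k))"
  proof (rule log_growth[OF L _ _ k_ge(2)])
    show "L \<le> ln (real (iter_prime n 0))" by (simp add: L_def)
  next
    fix j
    assume "L \<le> ln (real (iter_prime n j))"
    then show "ln (real (iter_prime n j)) + ln (ln (real (iter_prime n j))) - 106/1000
        \<le> ln (real (iter_prime n (Suc j)))"
      using L by (intro ln_iter_prime_step) auto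
  qed
  \<comment> \<open>Positivity is needed for \<open>exp\<close> to undo \<open>ln\<close>, because
    \<open>ln 0 = 0\<close> by convention.\<close>
  moreover have "iter_prime n k > 0"
    using assms prime_nth_prime by (cases k) (auto simp: prime_gt_0_nat)
  ultimately have "exp (log_bound L (real k)) < real (iter_prime n k)"
    by (metis exp_less_mono exp_ln of_nat_0_less_iff)
  moreover have "exp (log_bound L (real k)) = (exp 1 * real k * ln (real k) / ln L) ^ k"
  proof -
    have "0 < ln (real k)" "0 < ln L"
      using L k_ge by simp_all
    then show ?thesis
      using L k_ge unfolding log_bound_def by (simp add: exp_of_nat_mult exp_add exp_diff)
  qed
  ultimately show "real (iter_prime n k) > (exp 1 * real k * ln (real k) / ln (ln (real n))) ^ k"
    by (simp add: L_def)
qed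

end
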